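(* Let $\mathcal{E}$ be the ellipse parametrized by $P(t)=(a\cos t,b\sin t)$, $a,b>0$, and let $M=(x_0,y_0)$ be a point of the plane. The signed areas $A_p$ and $A_c$ of the pedal curve $\mathcal{E}_p$ and of the contrapedal curve $\mathcal{E}_c$ of $\mathcal{E}$ with respect to $M$ are $$A_p=\frac{\pi}{2}\left(a^2+b^2+x_0^2+y_0^2\right),\qquad A_c=\frac{\pi}{2}\left(a^2+b^2-2ab+x_0^2+y_0^2\right).$$
   Context: The pedal curve $\mathcal{E}_p$ (resp. contrapedal curve $\mathcal{E}_c$) with respect to $M$ is the closed curve $t\mapsto Q_p(t)$ (resp. $t\mapsto Q_c(t)$), $t\in[0,2\pi]$, where $Q_p(t)$ (resp. $Q_c(t)$) is the foot of the perpendicular dropped from $M$ onto the tangent line (resp. normal line) to $\mathcal{E}$ at $P(t)$. The signed area of a closed parametrized curve $\gamma$ is $\frac12\int_\gamma(x\,dy-y\,dx)$, with orientation given by increasing $t$. *)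

theory Defs
  imports "HOL-Analysis.Analysis"
begin

definition ellipse_param :: "real \<Rightarrow> real \<Rightarrow> real \<Rightarrow> real \<times> real" where
  "ellipse_param a b t = (a * cos t, b * sin t)"

definition tangent_line :: "(real \<Rightarrow> real \<times> real) \<Rightarrow> real \<Rightarrow> (real \<times> real) set" where
  "tangent_line \<gamma> t = {\<gamma> t + s *\<^sub>R vector_derivative \<gamma> (at t) | s. True}"

definition normal_line :: "(real \<Rightarrow> real \<times> real) \<Rightarrow> real \<Rightarrow> (real \<times> real) set" where
  "normal_line \<gamma> t = {X. (X - \<gamma> t) \<bullet> vector_derivative \<gamma> (at t) = 0}"

definition perp_foot :: "real \<times> real \<Rightarrow> (real \<times> real) set \<Rightarrow> real \<times> real" where
  "perp_foot M L = (THE Q. Q \<in> L \<and> (\<forall>X\<in>L. (M - Q) \<bullet> (X - Q) = 0))"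

definition pedal_curve :: "(real \<Rightarrow> real \<times> real) \<Rightarrow> real \<times> real \<Rightarrow> real \<Rightarrow> real \<times> real" where
  "pedal_curve \<gamma> M t = perp_foot M (tangent_line \<gamma> t)"

definition contrapedal_curve :: "(real \<Rightarrow> real \<times> real) \<Rightarrow> real \<times> real \<Rightarrow> real \<Rightarrow> real \<times> real" where
  "contrapedal_curve \<gamma> M t = perp_foot M (normal_line \<gamma> t)"

text \<open>The line integral of (x dy - y dx) / 2 along the curve \<open>\<gamma>\<close>, restricted to the parameter
  interval from \<open>\<alpha>\<close> to \<open>\<beta>\<close>; derivatives at the endpoints are one-sided. It is meant for
  \<open>\<alpha> < \<beta>\<close> and differentiable \<open>\<gamma>\<close> with \<open>\<gamma> \<alpha> = \<gamma> \<beta>\<close>.\<close>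

definition signed_area :: "real \<Rightarrow> real \<Rightarrow> (real \<Rightarrow> real \<times> real) \<Rightarrow> real" where
  "signed_area \<alpha> \<beta> \<gamma> = 1 / 2 * integral {\<alpha>..\<beta>}
     (\<lambda>t. fst (\<gamma> t) * snd (vector_derivative \<gamma> (at t within {\<alpha>..\<beta>}))
        - snd (\<gamma> t) * fst (vector_derivative \<gamma> (at t within {\<alpha>..\<beta>})))"

end

theory Submission
  imports Defs
begin

text \<open>Let \<open>T\<close> be the velocity of the ellipse and \<open>N\<close> its rotation by a right angle. Both lines at
  \<open>P(t)\<close> have the form \<open>{X. (X - P) \<bullet> n = 0}\<close>, with \<open>n = N\<close> for the tangent and \<open>n = T\<close> for the
  normal, so either foot is \<open>M + l n\<close> with \<open>l = ((P - M) \<bullet> n) / (n \<bullet> n)\<close>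
  (\<open>perp_foot_hyperplane\<close>). The area swept out about \<open>M\<close> by \<open>l n\<close> is half the integral of
  \<open>l\<^sup>2\<close> times the cross product of \<open>n\<close> and \<open>n'\<close>, because the translation by \<open>M\<close> contributes a
  total derivative (\<open>signed_area_about_point\<close>). For both choices of \<open>n\<close> that cross product is the
  constant \<open>ab\<close>, and \<open>n \<bullet> n\<close> is \<open>D = b\<^sup>2 cos\<^sup>2 t + a\<^sup>2 sin\<^sup>2 t\<close>. It remains to integrate
  \<open>ab ((P - M) \<bullet> n)\<^sup>2 / D\<^sup>2\<close> over a period.

  In the expanded square, the terms linear in \<open>M\<close> change sign under \<open>t \<mapsto> t + \<pi>\<close> and integrate to
  zero (\<open>has_integral_0_antiperiodic\<close>). The other terms reduce to the integrals over a period of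
  constants, of \<open>ab / D\<close> and of quadratic forms in \<open>cos t\<close>, \<open>sin t\<close> over \<open>D\<^sup>2\<close>. These are elementary in the angle
  \<open>\<phi>\<close> of the vector \<open>N = (b cos t, a sin t)\<close>, because \<open>\<phi>' = ab / D\<close>,
  \<open>cos\<^sup>2 \<phi> = b\<^sup>2 cos\<^sup>2 t / D\<close> and \<open>sin\<^sup>2 \<phi> = a\<^sup>2 sin\<^sup>2 t / D\<close>, while \<open>\<phi>\<close> increases by \<open>2 \<pi>\<close>.\<close>

section \<open>Feet of perpendiculars\<close>

text \<open>Lines in the plane are hyperplanes, and a hyperplane is the form in which the foot is
  easiest to write down: move from \<open>M\<close> along the normal \<open>n\<close>.\<close>

lemma perp_foot_hyperplane:
  assumes "n \<noteq> 0"
  shows "perp_foot M {X. (X - P) \<bullet> n = 0} = M + (((P - M) \<bullet> n) / (n \<bullet> n)) *\<^sub>R n"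
    (is "perp_foot M ?L = ?Q")
  unfolding perp_foot_def
proof (rule the_equality)
  have n: "n \<bullet> n \<noteq> 0" using assms by simp
  have Q: "(?Q - P) \<bullet> n = 0"
    using n by (simp add: inner_left_distrib inner_diff_left)
  moreover have "(M - ?Q) \<bullet> (X - ?Q) = 0" if "(X - P) \<bullet> n = 0" for X
  proof -
    have "(X - ?Q) \<bullet> n = 0"
      using that Q by (simp add: inner_diff_left)
    then show ?thesis by (simp add: inner_commute)
  qed
  ultimately show "?Q \<in> ?L \<and> (\<forall>X\<in>?L. (M - ?Q) \<bullet> (X - ?Q) = 0)" by blast
  fix R assume R: "R \<in> ?L \<and> (\<forall>X\<in>?L. (M - R) \<bullet> (X - R) = 0)"
  \<comment> \<open>\<open>R - ?Q\<close> is parallel to the hyperplane, hence orthogonal both to \<open>M - R\<close> and to \<open>M - ?Q\<close>,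
    which is a multiple of \<open>n\<close>; so it is orthogonal to itself.\<close>
  have "(M - R) \<bullet> (?Q - R) = 0" using R Q by blast
  moreover have "(?Q - R) \<bullet> n = 0"
    using R Q by (simp add: inner_diff_left)
  then have "(M - ?Q) \<bullet> (?Q - R) = 0" by (simp add: inner_commute)
  ultimately have "((M - R) - (M - ?Q)) \<bullet> (?Q - R) = 0"
    by (simp only: inner_diff_left[of "M - R"])
  moreover have "(M - R) - (M - ?Q) = ?Q - R" by (simp only: diff_diff_eq2 algebra_simps)
  ultimately show "R = ?Q" by (simp only: inner_eq_zero_iff) auto
qed

lemma tangent_line_hyperplane:
  assumes v: "vector_derivative \<gamma> (at t) = (u, v)" and nz: "(u, v) \<noteq> 0"
  shows "tangent_line \<gamma> t = {X. (X - \<gamma> t) \<bullet> (v, - u) = 0}"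
proof (intro set_eqI iffI)
  fix X assume "X \<in> tangent_line \<gamma> t"
  then show "X \<in> {X. (X - \<gamma> t) \<bullet> (v, - u) = 0}"
    unfolding tangent_line_def v by (auto simp: inner_prod_def)
next
  fix X assume X: "X \<in> {X. (X - \<gamma> t) \<bullet> (v, - u) = 0}"
  obtain x y where xy: "X - \<gamma> t = (x, y)" by fastforce
  have orth: "x * v = y * u" using X by (simp add: xy)
  have d: "u * u + v * v \<noteq> 0" using nz by (simp add: zero_prod_def)
  define s where "s = (x * u + y * v) / (u * u + v * v)"
  have "x * (u * u + v * v) = (x * u + y * v) * u" "y * (u * u + v * v) = (x * u + y * v) * v"
    using orth by algebra+
  then have "x = s * u" "y = s * v"
    using d by (simp_all add: s_def nonzero_eq_divide_eq)
  then have "X - \<gamma> t = s *\<^sub>R (u, v)" using xy by simp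
  then have "X = \<gamma> t + s *\<^sub>R (u, v)" by (simp add: algebra_simps)
  then show "X \<in> tangent_line \<gamma> t" unfolding tangent_line_def v by blast
qed

section \<open>Area swept out about a point\<close>

text \<open>Moving the origin to \<open>M\<close> changes the integrand by the derivative of the cross product of \<open>M\<close>
  with the curve, which integrates to zero over a closed curve. About \<open>M\<close>, the factor \<open>l\<close>
  contributes no derivative term, since \<open>l' n\<close> is parallel to \<open>l n\<close>.\<close>

lemma signed_area_about_point:
  fixes n n' :: "real \<Rightarrow> real \<times> real" and l :: "real \<Rightarrow> real"
  assumes "\<alpha> < \<beta>"
    and \<gamma>: "\<And>t. \<gamma> t = M + l t *\<^sub>R n t"
    and l: "\<And>t. l differentiable (at t)"
    and n: "\<And>t. (n has_vector_derivative n' t) (at t)"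
    and closed: "\<gamma> \<alpha> = \<gamma> \<beta>"
    and I: "((\<lambda>t. (l t)\<^sup>2 * (fst (n t) * snd (n' t) - snd (n t) * fst (n' t))) has_integral I)
              {\<alpha>..\<beta>}"
  shows "signed_area \<alpha> \<beta> \<gamma> = I / 2"
proof -
  define \<gamma>' where "\<gamma>' t = l t *\<^sub>R n' t + deriv l t *\<^sub>R n t" for t
  have \<gamma>_eq: "\<gamma> = (\<lambda>t. M + l t *\<^sub>R n t)" using \<gamma> by blast
  have "(l has_real_derivative deriv l t) (at t)" for t
    using l DERIV_deriv_iff_real_differentiable by blast
  then have d\<gamma>: "(\<gamma> has_vector_derivative \<gamma>' t) (at t within S)" for t S
    unfolding \<gamma>_eq \<gamma>'_def using n
    by (auto intro!: derivative_eq_intros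
             intro: has_vector_derivative_at_within has_field_derivative_at_within)
  define g where "g t = fst M * snd (\<gamma> t) - snd M * fst (\<gamma> t)" for t
  have "(g has_vector_derivative fst M * snd (\<gamma>' t) - snd M * fst (\<gamma>' t)) (at t within {\<alpha>..\<beta>})" for t
    unfolding g_def using d\<gamma>[of t "{\<alpha>..\<beta>}"]
    by (auto simp: has_vector_derivative_def intro!: derivative_eq_intros)
       (auto simp: fun_eq_iff algebra_simps)
  then have "((\<lambda>t. fst M * snd (\<gamma>' t) - snd M * fst (\<gamma>' t)) has_integral (g \<beta> - g \<alpha>)) {\<alpha>..\<beta>}"
    using \<open>\<alpha> < \<beta>\<close> by (intro fundamental_theorem_of_calculus) auto
  then have "((\<lambda>t. fst M * snd (\<gamma>' t) - snd M * fst (\<gamma>' t)) has_integral 0) {\<alpha>..\<beta>}"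
    using closed by (simp add: g_def)
  from has_integral_add[OF this I]
  have "((\<lambda>t. fst (\<gamma> t) * snd (\<gamma>' t) - snd (\<gamma> t) * fst (\<gamma>' t)) has_integral I) {\<alpha>..\<beta>}"
    by (rule has_integral_eq_rhs[OF has_integral_eq[rotated]])
       (auto simp: \<gamma> \<gamma>'_def power2_eq_square algebra_simps)
  moreover have "vector_derivative \<gamma> (at t within {\<alpha>..\<beta>}) = \<gamma>' t" if "t \<in> {\<alpha>..\<beta>}" for t
    using vector_derivative_within_cbox[of \<alpha> \<beta> t \<gamma>] d\<gamma> that \<open>\<alpha> < \<beta>\<close> by auto
  ultimately have "((\<lambda>t. fst (\<gamma> t) * snd (vector_derivative \<gamma> (at t within {\<alpha>..\<beta>}))
        - snd (\<gamma> t) * fst (vector_derivative \<gamma> (at t within {\<alpha>..\<beta>}))) has_integral I) {\<alpha>..\<beta>}"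
    by (subst has_integral_cong[where g = "\<lambda>t. fst (\<gamma> t) * snd (\<gamma>' t) - snd (\<gamma> t) * fst (\<gamma>' t)"]) auto
  then show ?thesis
    unfolding signed_area_def by (simp add: integral_unique)
qed

section \<open>Integrals over a period\<close>

text \<open>The integrals over the two halves of the interval cancel.\<close>

lemma has_integral_0_antiperiodic:
  fixes f :: "real \<Rightarrow> real"
  assumes "continuous_on UNIV f" and "0 \<le> c" and anti: "\<And>t. f (t + c) = - f t"
  shows "(f has_integral 0) {0..2 * c}"
proof -
  have 1: "(f has_integral integral {0..c} f) {0..c}"
    using assms(1) continuous_on_subset integrable_continuous_real integrable_integral by blast
  then have "((\<lambda>t. f (t + c)) has_integral - integral {0..c} f) {0..c}"
    unfolding anti by (rule has_integral_neg)
  then have 2: "(f has_integral - integral {0..c} f) {c..2 * c}"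
    using has_integral_shift_real_ivl_iff[of f _ c "2 * c" c] by simp
  show ?thesis
    using has_integral_combine[OF _ _ 1 2] \<open>0 \<le> c\<close> by simp
qed

locale ellipse =
  fixes a b :: real
  assumes a: "a > 0" and b: "b > 0"
begin

text \<open>The squared speed of the ellipse.\<close>

definition D :: "real \<Rightarrow> real" where
  "D t = b\<^sup>2 * (cos t)\<^sup>2 + a\<^sup>2 * (sin t)\<^sup>2"

lemma D_pos: "D t > 0"
proof (cases "cos t = 0")
  case True
  then have "(sin t)\<^sup>2 = 1" using sin_cos_squared_add[of t] by simp
  then show ?thesis using a True by (simp add: D_def)
next
  case False
  then show ?thesis using b by (simp add: D_def add_pos_nonneg)
qed

lemma D_nz: "D t \<noteq> 0"
  using D_pos[of t] by simp

lemma D_periodic: "D (t + pi) = D t" "D (2 * pi) = D 0"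
  by (simp_all add: D_def)

lemma D_DERIV: "(D has_real_derivative 2 * (a\<^sup>2 - b\<^sup>2) * sin t * cos t) (at t within S)"
  unfolding D_def by (auto intro!: derivative_eq_intros simp: algebra_simps)

text \<open>The primitive is the angle of \<open>(b cos t, a sin t)\<close>, written as \<open>t\<close> plus its deviation from \<open>t\<close>
  so that it is smooth on the whole period.\<close>

lemma integral_angle: "((\<lambda>t. a * b / D t) has_integral 2 * pi) {0..2 * pi}"
proof -
  define w where "w t = b * (cos t)\<^sup>2 + a * (sin t)\<^sup>2" for t
  define z where "z t = (a - b) * sin t * cos t" for t
  define \<phi> where "\<phi> t = t + arctan (z t / w t)" for t
  have w: "w t > 0" for t
  proof (cases "cos t = 0")
    case True
    then have "(sin t)\<^sup>2 = 1" using sin_cos_squared_add[of t] by simp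
    then show ?thesis using a True by (simp add: w_def)
  next
    case False
    then show ?thesis using a b by (simp add: w_def add_pos_nonneg)
  qed
  have "(\<phi> has_real_derivative a * b / D t) (at t)" for t
  proof -
    define w' where "w' = 2 * (a - b) * sin t * cos t"
    define z' where "z' = (a - b) * ((cos t)\<^sup>2 - (sin t)\<^sup>2)"
    have dw: "(w has_real_derivative w') (at t)"
      unfolding w_def w'_def by (auto intro!: derivative_eq_intros simp: algebra_simps)
    have dz: "(z has_real_derivative z') (at t)"
      unfolding z_def z'_def
      by (auto intro!: derivative_eq_intros simp: algebra_simps power2_eq_square)
    have norm: "(w t)\<^sup>2 + (z t)\<^sup>2 = D t"
      unfolding w_def z_def D_def using sin_cos_squared_add[of t] by algebra
    have num: "D t + (z' * w t - z t * w') = a * b"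
      unfolding w_def z_def D_def w'_def z'_def using sin_cos_squared_add[of t] by algebra
    have "(\<phi> has_real_derivative 1 + (z' * w t - z t * w') / (w t * w t) / (1 + (z t / w t)\<^sup>2)) (at t)"
      unfolding \<phi>_def using w[of t]
      by (auto intro!: derivative_eq_intros dw dz simp: divide_simps)
    moreover have "(w t * w t) * (1 + (z t / w t)\<^sup>2) = D t"
      using w[of t] norm by (simp add: field_simps power2_eq_square)
    then have "1 + (z' * w t - z t * w') / (w t * w t) / (1 + (z t / w t)\<^sup>2)
        = (D t + (z' * w t - z t * w')) / D t"
      using D_nz[of t] by (simp add: divide_divide_eq_left add_divide_distrib)
    ultimately show ?thesis using num by simp
  qed
  then have "((\<lambda>t. a * b / D t) has_integral (\<phi> (2 * pi) - \<phi> 0)) {0..2 * pi}"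
    by (intro fundamental_theorem_of_calculus)
       (auto simp: has_real_derivative_iff_has_vector_derivative[symmetric]
             intro: has_field_derivative_at_within)
  then show ?thesis by (simp add: \<phi>_def z_def)
qed

text \<open>In the angle \<open>\<phi>\<close> of \<open>(b cos t, a sin t)\<close>, the integrand is \<open>cos (2 \<phi>) \<phi>'\<close> and its primitive
  \<open>sin (2 \<phi>) / 2\<close>.\<close>

lemma integral_cos_double_angle:
  "((\<lambda>t. a * b * (b\<^sup>2 * (cos t)\<^sup>2 - a\<^sup>2 * (sin t)\<^sup>2) / (D t)\<^sup>2) has_integral 0) {0..2 * pi}"
proof -
  define k where "k t = a * b * sin t * cos t / D t" for t
  have "(k has_real_derivative a * b * (b\<^sup>2 * (cos t)\<^sup>2 - a\<^sup>2 * (sin t)\<^sup>2) / (D t)\<^sup>2) (at t)" for t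
  proof -
    have "(k has_real_derivative
        ((a * b * ((cos t)\<^sup>2 - (sin t)\<^sup>2)) * D t
          - a * b * sin t * cos t * (2 * (a\<^sup>2 - b\<^sup>2) * sin t * cos t)) / (D t * D t)) (at t)"
      unfolding k_def
      by (rule DERIV_divide[OF _ D_DERIV D_nz])
         (auto intro!: derivative_eq_intros simp: algebra_simps power2_eq_square)
    moreover have "(a * b * ((cos t)\<^sup>2 - (sin t)\<^sup>2)) * D t
          - a * b * sin t * cos t * (2 * (a\<^sup>2 - b\<^sup>2) * sin t * cos t)
        = a * b * (b\<^sup>2 * (cos t)\<^sup>2 - a\<^sup>2 * (sin t)\<^sup>2)"
      unfolding D_def using sin_cos_squared_add[of t] by algebra
    ultimately show ?thesis by (simp add: power2_eq_square)
  qed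
  then have "((\<lambda>t. a * b * (b\<^sup>2 * (cos t)\<^sup>2 - a\<^sup>2 * (sin t)\<^sup>2) / (D t)\<^sup>2) has_integral
      (k (2 * pi) - k 0)) {0..2 * pi}"
    by (intro fundamental_theorem_of_calculus)
       (auto simp: has_real_derivative_iff_has_vector_derivative[symmetric]
             intro: has_field_derivative_at_within)
  then show ?thesis by (simp add: k_def)
qed

text \<open>The primitive \<open>- cos\<^sup>2 t / (2 a\<^sup>2 D)\<close> is, up to a constant factor, \<open>cos\<^sup>2 \<phi>\<close>; unlike \<open>1 / D\<close>, it also
  serves for the circle.\<close>

lemma integral_sin_double_angle: "((\<lambda>t. sin t * cos t / (D t)\<^sup>2) has_integral 0) {0..2 * pi}"
proof -
  define k where "k t = - (cos t)\<^sup>2 / (2 * a\<^sup>2) / D t" for t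
  have "(k has_real_derivative sin t * cos t / (D t)\<^sup>2) (at t)" for t
  proof -
    have "(k has_real_derivative
        ((sin t * cos t / a\<^sup>2) * D t
          - (- (cos t)\<^sup>2 / (2 * a\<^sup>2)) * (2 * (a\<^sup>2 - b\<^sup>2) * sin t * cos t)) / (D t * D t)) (at t)"
      unfolding k_def
      by (rule DERIV_divide[OF _ D_DERIV D_nz])
         (use a in \<open>auto intro!: derivative_eq_intros simp: field_simps power2_eq_square\<close>)
    moreover have "(sin t * cos t / a\<^sup>2) * D t
          - (- (cos t)\<^sup>2 / (2 * a\<^sup>2)) * (2 * (a\<^sup>2 - b\<^sup>2) * sin t * cos t)
        = sin t * cos t * ((D t + (cos t)\<^sup>2 * (a\<^sup>2 - b\<^sup>2)) / a\<^sup>2)"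
      using a by (simp add: field_simps)
    moreover have "D t + (cos t)\<^sup>2 * (a\<^sup>2 - b\<^sup>2) = a\<^sup>2"
      unfolding D_def using sin_cos_squared_add[of t] by algebra
    ultimately show ?thesis using a by (simp add: power2_eq_square)
  qed
  then have "((\<lambda>t. sin t * cos t / (D t)\<^sup>2) has_integral (k (2 * pi) - k 0)) {0..2 * pi}"
    by (intro fundamental_theorem_of_calculus)
       (auto simp: has_real_derivative_iff_has_vector_derivative[symmetric]
             intro: has_field_derivative_at_within)
  then show ?thesis by (simp add: k_def D_periodic)
qed

text \<open>Over a full turn of \<open>\<phi>\<close>, both \<open>cos\<^sup>2 \<phi>\<close> and \<open>sin\<^sup>2 \<phi>\<close> have mean \<open>1/2\<close>, and \<open>sin \<phi> cos \<phi>\<close> has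
  mean zero, so a quadratic form contributes \<open>\<pi>\<close> times its trace.\<close>

lemma integral_quadratic_form:
  "((\<lambda>t. a * b * (A * (b * cos t)\<^sup>2 + 2 * B * (b * cos t) * (a * sin t) + C * (a * sin t)\<^sup>2) / (D t)\<^sup>2)
     has_integral pi * (A + C)) {0..2 * pi}"
proof -
  have "((\<lambda>t. (A + C) / 2 * (a * b / D t)
      + (A - C) / 2 * (a * b * (b\<^sup>2 * (cos t)\<^sup>2 - a\<^sup>2 * (sin t)\<^sup>2) / (D t)\<^sup>2)
      + 2 * B * a\<^sup>2 * b\<^sup>2 * (sin t * cos t / (D t)\<^sup>2))
    has_integral (A + C) / 2 * (2 * pi) + (A - C) / 2 * 0 + 2 * B * a\<^sup>2 * b\<^sup>2 * 0) {0..2 * pi}"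
    by (intro has_integral_add has_integral_mult_right integral_angle
        integral_cos_double_angle integral_sin_double_angle)
  moreover have "(A + C) / 2 * (a * b / D t)
      + (A - C) / 2 * (a * b * (b\<^sup>2 * (cos t)\<^sup>2 - a\<^sup>2 * (sin t)\<^sup>2) / (D t)\<^sup>2)
      + 2 * B * a\<^sup>2 * b\<^sup>2 * (sin t * cos t / (D t)\<^sup>2)
    = a * b * (A * (b * cos t)\<^sup>2 + 2 * B * (b * cos t) * (a * sin t) + C * (a * sin t)\<^sup>2) / (D t)\<^sup>2"
    for t
  proof -
    have "a * b / D t = a * b * D t / (D t)\<^sup>2"
      using D_nz[of t] by (simp add: power2_eq_square)
    then have "(A + C) / 2 * (a * b / D t)
      + (A - C) / 2 * (a * b * (b\<^sup>2 * (cos t)\<^sup>2 - a\<^sup>2 * (sin t)\<^sup>2) / (D t)\<^sup>2)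
      + 2 * B * a\<^sup>2 * b\<^sup>2 * (sin t * cos t / (D t)\<^sup>2)
      = ((A + C) / 2 * (a * b * D t) + (A - C) / 2 * (a * b * (b\<^sup>2 * (cos t)\<^sup>2 - a\<^sup>2 * (sin t)\<^sup>2))
          + 2 * B * a\<^sup>2 * b\<^sup>2 * (sin t * cos t)) / (D t)\<^sup>2"
      by (simp only: add_divide_distrib times_divide_eq_right)
    moreover have "(A + C) / 2 * (a * b * D t)
          + (A - C) / 2 * (a * b * (b\<^sup>2 * (cos t)\<^sup>2 - a\<^sup>2 * (sin t)\<^sup>2))
          + 2 * B * a\<^sup>2 * b\<^sup>2 * (sin t * cos t)
      = a * b * (A * (b * cos t)\<^sup>2 + 2 * B * (b * cos t) * (a * sin t) + C * (a * sin t)\<^sup>2)"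
      by (simp add: D_def field_simps power2_eq_square)
    ultimately show ?thesis by simp
  qed
  ultimately show ?thesis by (simp add: mult.commute)
qed

text \<open>The numerators to which this is applied are homogeneous of odd degree in \<open>cos t\<close>, \<open>sin t\<close>.\<close>

lemma integral_odd_numerator:
  assumes "continuous_on UNIV h" and "\<And>t. h (t + pi) = - h t"
  shows "((\<lambda>t. h t / (D t)\<^sup>2) has_integral 0) {0..2 * pi}"
proof (rule has_integral_0_antiperiodic)
  show "continuous_on UNIV (\<lambda>t. h t / (D t)\<^sup>2)"
    using D_nz by (intro continuous_intros assms(1)) (auto simp: D_def intro!: continuous_intros)
qed (simp_all add: assms(2) D_periodic)

section \<open>The pedal and contrapedal curves of the ellipse\<close>

lemma ellipse_velocity: "vector_derivative (ellipse_param a b) (at t) = (- a * sin t, b * cos t)"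
  unfolding ellipse_param_def
  by (rule vector_derivative_at)
     (auto simp: has_vector_derivative_def fun_eq_iff intro!: derivative_eq_intros)

lemma velocity_nonzero: "(- a * sin t, b * cos t) \<noteq> 0"
  using D_nz[of t] by (auto simp: D_def zero_prod_def)

lemma pedal_curve_ellipse:
  "pedal_curve (ellipse_param a b) (x0, y0) t
     = (x0, y0) + ((a * b - x0 * b * cos t - y0 * a * sin t) / D t) *\<^sub>R (b * cos t, a * sin t)"
proof -
  have nz: "(b * cos t, a * sin t) \<noteq> 0"
    using velocity_nonzero[of t] by (auto simp: zero_prod_def)
  have "a * (b * (cos t * cos t)) + a * (b * (sin t * sin t)) = a * b"
    using sin_cos_squared_add[of t] by algebra
  then have 1: "(ellipse_param a b t - (x0, y0)) \<bullet> (b * cos t, a * sin t)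
      = a * b - x0 * b * cos t - y0 * a * sin t"
    by (simp add: ellipse_param_def algebra_simps)
  have 2: "(b * cos t, a * sin t) \<bullet> (b * cos t, a * sin t) = D t"
    by (simp add: D_def power2_eq_square)
  have "tangent_line (ellipse_param a b) t
      = {X. (X - ellipse_param a b t) \<bullet> (b * cos t, a * sin t) = 0}"
    using tangent_line_hyperplane[OF ellipse_velocity velocity_nonzero] by simp
  then show ?thesis
    unfolding pedal_curve_def using perp_foot_hyperplane[OF nz] 1 2 by simp
qed

lemma contrapedal_curve_ellipse:
  "contrapedal_curve (ellipse_param a b) (x0, y0) t
     = (x0, y0) + (((b\<^sup>2 - a\<^sup>2) * sin t * cos t + x0 * a * sin t - y0 * b * cos t) / D t)
         *\<^sub>R (- a * sin t, b * cos t)"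
proof -
  have 1: "(ellipse_param a b t - (x0, y0)) \<bullet> (- a * sin t, b * cos t)
      = (b\<^sup>2 - a\<^sup>2) * sin t * cos t + x0 * a * sin t - y0 * b * cos t"
    by (simp add: ellipse_param_def algebra_simps power2_eq_square)
  have 2: "(- a * sin t, b * cos t) \<bullet> (- a * sin t, b * cos t) = D t"
    by (simp add: D_def power2_eq_square)
  show ?thesis
    unfolding contrapedal_curve_def normal_line_def ellipse_velocity
      perp_foot_hyperplane[OF velocity_nonzero] 1 2 ..
qed

lemma signed_area_pedal:
  "signed_area 0 (2 * pi) (pedal_curve (ellipse_param a b) (x0, y0))
     = pi * (a\<^sup>2 + b\<^sup>2 + x0\<^sup>2 + y0\<^sup>2) / 2"
proof (rule signed_area_about_point[OF _ pedal_curve_ellipse,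
      where n' = "\<lambda>t. (- b * sin t, a * cos t)"])
  define h where "h t = - 2 * a * b * (a * b) * (x0 * b * cos t + y0 * a * sin t)" for t
  show "(\<lambda>t. (a * b - x0 * b * cos t - y0 * a * sin t) / D t) differentiable at t" for t
    unfolding real_differentiable_def
    by (rule exI, rule DERIV_divide[OF _ D_DERIV D_nz]) (rule derivative_eq_intros refl)+
  show "((\<lambda>t. (b * cos t, a * sin t)) has_vector_derivative (- b * sin t, a * cos t)) (at t)" for t
    by (auto simp: has_vector_derivative_def fun_eq_iff intro!: derivative_eq_intros)
  show "pedal_curve (ellipse_param a b) (x0, y0) 0 = pedal_curve (ellipse_param a b) (x0, y0) (2 * pi)"
    by (simp add: pedal_curve_ellipse D_periodic)
  have "((\<lambda>t. h t / (D t)\<^sup>2) has_integral 0) {0..2 * pi}"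
    by (rule integral_odd_numerator)
       (auto simp: h_def algebra_simps intro!: continuous_intros)
  \<comment> \<open>The diagonal coefficients \<open>a\<^sup>2\<close>, \<open>b\<^sup>2\<close> come from the constant
    \<open>(P \<bullet> N)\<^sup>2 = a\<^sup>2 b\<^sup>2 = a\<^sup>2 (b cos t)\<^sup>2 + b\<^sup>2 (a sin t)\<^sup>2\<close>.\<close>
  from has_integral_add[OF integral_quadratic_form[of "a\<^sup>2 + x0\<^sup>2" "x0 * y0" "b\<^sup>2 + y0\<^sup>2"] this]
  show "((\<lambda>t. ((a * b - x0 * b * cos t - y0 * a * sin t) / D t)\<^sup>2 *
      (fst (b * cos t, a * sin t) * snd (- b * sin t, a * cos t)
        - snd (b * cos t, a * sin t) * fst (- b * sin t, a * cos t)))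
    has_integral pi * (a\<^sup>2 + b\<^sup>2 + x0\<^sup>2 + y0\<^sup>2)) {0..2 * pi}"
  proof (rule has_integral_eq_rhs[OF has_integral_eq[rotated]])
    fix t
    have "a * b * ((a\<^sup>2 + x0\<^sup>2) * (b * cos t)\<^sup>2 + 2 * (x0 * y0) * (b * cos t) * (a * sin t)
          + (b\<^sup>2 + y0\<^sup>2) * (a * sin t)\<^sup>2) + h t
        = (a * b - x0 * b * cos t - y0 * a * sin t)\<^sup>2 * (a * b)"
      unfolding h_def using sin_cos_squared_add[of t] by algebra
    moreover have "b * cos t * (a * cos t) - a * sin t * (- b * sin t) = a * b"
      using sin_cos_squared_add[of t] by algebra
    ultimately show "a * b * ((a\<^sup>2 + x0\<^sup>2) * (b * cos t)\<^sup>2 + 2 * (x0 * y0) * (b * cos t) * (a * sin t)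
          + (b\<^sup>2 + y0\<^sup>2) * (a * sin t)\<^sup>2) / (D t)\<^sup>2 + h t / (D t)\<^sup>2
        = ((a * b - x0 * b * cos t - y0 * a * sin t) / D t)\<^sup>2 *
          (fst (b * cos t, a * sin t) * snd (- b * sin t, a * cos t)
            - snd (b * cos t, a * sin t) * fst (- b * sin t, a * cos t))"
      unfolding fst_conv snd_conv by (simp only: add_divide_distrib[symmetric] power_divide times_divide_eq_left)
  qed (simp add: algebra_simps)
qed simp

text \<open>The square of \<open>P \<bullet> T\<close> is in general not a quadratic form in \<open>N\<close>, unlike that of \<open>P \<bullet> N\<close>. Since \<open>N\<close> and \<open>T\<close>
  are orthogonal of squared length \<open>D\<close>, it equals \<open>(P \<bullet> P) D - (P \<bullet> N)\<^sup>2\<close>, where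
  \<open>P \<bullet> P = a\<^sup>2 + b\<^sup>2 - D\<close>; this yields the terms in \<open>ab / D\<close> and the constant \<open>ab\<close>.\<close>

lemma signed_area_contrapedal:
  "signed_area 0 (2 * pi) (contrapedal_curve (ellipse_param a b) (x0, y0))
     = pi * (a\<^sup>2 + b\<^sup>2 - 2 * a * b + x0\<^sup>2 + y0\<^sup>2) / 2"
proof (rule signed_area_about_point[OF _ contrapedal_curve_ellipse,
      where n' = "\<lambda>t. (- a * cos t, - b * sin t)"])
  define h where "h t = 2 * a * b * (b\<^sup>2 - a\<^sup>2) * sin t * cos t * (x0 * a * sin t - y0 * b * cos t)" for t
  define q where "q t = a * b * ((y0\<^sup>2 - a\<^sup>2) * (b * cos t)\<^sup>2
    + 2 * (- (x0 * y0)) * (b * cos t) * (a * sin t) + (x0\<^sup>2 - b\<^sup>2) * (a * sin t)\<^sup>2)" for t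
  show "(\<lambda>t. ((b\<^sup>2 - a\<^sup>2) * sin t * cos t + x0 * a * sin t - y0 * b * cos t) / D t) differentiable at t" for t
    unfolding real_differentiable_def
    by (rule exI, rule DERIV_divide[OF _ D_DERIV D_nz]) (rule derivative_eq_intros refl)+
  show "((\<lambda>t. (- a * sin t, b * cos t)) has_vector_derivative (- a * cos t, - b * sin t)) (at t)" for t
    by (auto simp: has_vector_derivative_def fun_eq_iff intro!: derivative_eq_intros)
  show "contrapedal_curve (ellipse_param a b) (x0, y0) 0
      = contrapedal_curve (ellipse_param a b) (x0, y0) (2 * pi)"
    by (simp add: contrapedal_curve_ellipse D_periodic)
  have "((\<lambda>t. h t / (D t)\<^sup>2) has_integral 0) {0..2 * pi}"
    by (rule integral_odd_numerator)
       (auto simp: h_def algebra_simps intro!: continuous_intros)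
  moreover have "((\<lambda>t. q t / (D t)\<^sup>2) has_integral pi * (y0\<^sup>2 - a\<^sup>2 + (x0\<^sup>2 - b\<^sup>2))) {0..2 * pi}"
    unfolding q_def by (rule integral_quadratic_form)
  moreover have "((\<lambda>t. (a\<^sup>2 + b\<^sup>2) * (a * b / D t) - a * b)
      has_integral (a\<^sup>2 + b\<^sup>2) * (2 * pi) - 2 * pi * (a * b)) {0..2 * pi}"
    using has_integral_const_real[of "a * b" 0 "2 * pi"]
    by (intro has_integral_diff has_integral_mult_right integral_angle) simp_all
  ultimately have "((\<lambda>t. (a\<^sup>2 + b\<^sup>2) * (a * b / D t) - a * b + (q t / (D t)\<^sup>2 + h t / (D t)\<^sup>2))
      has_integral (a\<^sup>2 + b\<^sup>2) * (2 * pi) - 2 * pi * (a * b)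
        + (pi * (y0\<^sup>2 - a\<^sup>2 + (x0\<^sup>2 - b\<^sup>2)) + 0)) {0..2 * pi}"
    by (intro has_integral_add)
  then show "((\<lambda>t. (((b\<^sup>2 - a\<^sup>2) * sin t * cos t + x0 * a * sin t - y0 * b * cos t) / D t)\<^sup>2 *
      (fst (- a * sin t, b * cos t) * snd (- a * cos t, - b * sin t)
        - snd (- a * sin t, b * cos t) * fst (- a * cos t, - b * sin t)))
    has_integral pi * (a\<^sup>2 + b\<^sup>2 - 2 * a * b + x0\<^sup>2 + y0\<^sup>2)) {0..2 * pi}"
  proof (rule has_integral_eq_rhs[OF has_integral_eq[rotated]])
    fix t
    have "(a\<^sup>2 + b\<^sup>2) * (a * b) * D t - a * b * (D t)\<^sup>2 + q t + h t
        = ((b\<^sup>2 - a\<^sup>2) * sin t * cos t + x0 * a * sin t - y0 * b * cos t)\<^sup>2 * (a * b)"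
      unfolding h_def q_def D_def using sin_cos_squared_add[of t] by algebra
    moreover have "(a\<^sup>2 + b\<^sup>2) * (a * b / D t) - a * b
        = ((a\<^sup>2 + b\<^sup>2) * (a * b) * D t - a * b * (D t)\<^sup>2) / (D t)\<^sup>2"
      using D_nz[of t] by (simp add: field_simps power2_eq_square)
    moreover have "- a * sin t * (- b * sin t) - b * cos t * (- a * cos t) = a * b"
      using sin_cos_squared_add[of t] by algebra
    ultimately show "(a\<^sup>2 + b\<^sup>2) * (a * b / D t) - a * b + (q t / (D t)\<^sup>2 + h t / (D t)\<^sup>2)
        = (((b\<^sup>2 - a\<^sup>2) * sin t * cos t + x0 * a * sin t - y0 * b * cos t) / D t)\<^sup>2 *
          (fst (- a * sin t, b * cos t) * snd (- a * cos t, - b * sin t)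
            - snd (- a * sin t, b * cos t) * fst (- a * cos t, - b * sin t))"
      unfolding fst_conv snd_conv
      by (simp only: add_divide_distrib[symmetric] power_divide times_divide_eq_left add.assoc[symmetric])
  qed (simp add: algebra_simps)
qed simp

end

theorem proposition2:
  fixes a b x0 y0 :: real
  assumes "a > 0" and "b > 0"
  shows "signed_area 0 (2 * pi) (pedal_curve (ellipse_param a b) (x0, y0))
           = pi / 2 * (a\<^sup>2 + b\<^sup>2 + x0\<^sup>2 + y0\<^sup>2)
       \<and> signed_area 0 (2 * pi) (contrapedal_curve (ellipse_param a b) (x0, y0))
           = pi / 2 * (a\<^sup>2 + b\<^sup>2 - 2 * a * b + x0\<^sup>2 + y0\<^sup>2)"
proof -
  interpret ellipse a b using assms by unfold_locales
  show ?thesis by (simp add: signed_area_pedal signed_area_contrapedal)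
qed

end
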